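(* Inner and outer approximations of the Minkowski sum of two sets $\mathcal{X}(\underline{p}_1,\overline{p}_1,r_1)$ and $\mathcal{X}(\underline{p}_2,\overline{p}_2,r_2)$ are given by $$\mathcal{X}(\underline{p}_1+\underline{p}_2,\overline{p}_1+\overline{p}_2,\rho)\subseteq\mathcal{X}(\underline{p}_1,\overline{p}_1,r_1)\oplus\mathcal{X}(\underline{p}_2,\overline{p}_2,r_2)\subseteq\mathcal{X}(\underline{p}_1+\underline{p}_2,\overline{p}_1+\overline{p}_2,r_1+r_2)$$ for any $\rho>0$ satisfying the condition $$\rho^2\le r_1^2+r_2^2+\alpha-\beta_1-\beta_2+2\sqrt{(r_1^2-\beta_1)(r_2^2-\beta_2)},$$ where $$\alpha:=\big[\max\{\underline{p}_1+\underline{p}_2,\ \min\{0,\overline{p}_1+\overline{p}_2\}\}\big]^2,\qquad \beta_i:=\max\{\underline{p}_i^2,\overline{p}_i^2\},\quad i=1,2.$$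
   Context: For given real parameters $\underline{p},\overline{p}$ and $r>0$ define $$\mathcal{X}(\underline{p},\overline{p},r):=\{[P,Q]^{\mathsf T}\in\mathbb{R}^2:\ \underline{p}\le P\le\overline{p},\ P^2+Q^2\le r^2\}.$$ Here $\underline{p}_1,\overline{p}_1,\underline{p}_2,\overline{p}_2$ are given real numbers and $r_1,r_2>0$. $\mathcal{X}_1\oplus\mathcal{X}_2$ denotes the Minkowski sum of $\mathcal{X}_1$ and $\mathcal{X}_2$.
   Formalization: For the inner inclusion it is additionally assumed that $\underline{p}_i\le\overline{p}_i$ and $\beta_i\le r_i^2$ for $i=1,2$; without these it can fail or the square root may be undefined. *)

theory Defs
  imports "HOL-Analysis.Analysis"
begin

definition pq_set :: "real \<Rightarrow> real \<Rightarrow> real \<Rightarrow> (real ^ 2) set" where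
  "pq_set pl pu r = {x. pl \<le> x $ 1 \<and> x $ 1 \<le> pu \<and> (x $ 1)\<^sup>2 + (x $ 2)\<^sup>2 \<le> r\<^sup>2}"

(* If pl1 + pl2 \<le> pu1 + pu2, this is the least value of P^2 over [pl1 + pl2, pu1 + pu2]. *)
definition alpha :: "real \<Rightarrow> real \<Rightarrow> real \<Rightarrow> real \<Rightarrow> real" where
  "alpha pl1 pu1 pl2 pu2 = (max (pl1 + pl2) (min 0 (pu1 + pu2)))\<^sup>2"

(* The greatest value of P^2 over a nonempty interval [pl, pu]. Since sqrt is odd on the reals here,
   beta pl pu \<le> r^2 has to be required explicitly before sqrt (r^2 - beta pl pu) can be read as usual. *)
definition beta :: "real \<Rightarrow> real \<Rightarrow> real" where
  "beta pl pu = max (pl\<^sup>2) (pu\<^sup>2)"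

end

theory Submission imports Defs
begin

text \<open>Over an interval of abscissae \<open>P\<close> the disc of radius \<open>r\<close> contains the ordinates with
  \<open>\<bar>Q\<bar> \<le> sqrt (r\<^sup>2 - P\<^sup>2)\<close>; the worst abscissa gives \<open>P\<^sup>2 = beta\<close>, so as soon as
  \<open>beta \<le> r\<^sup>2\<close> the \<open>pq_set\<close> contains the rectangle over its interval of half-height \<open>h = sqrt (r\<^sup>2 - beta)\<close>
  (\<open>rectangle_subset_pq_set\<close>). The Minkowski sum of the two rectangles is the rectangle over the
  summed interval of half-height \<open>h\<^sub>1 + h\<^sub>2\<close>, since the Minkowski sum of two intervals is the interval
  between the summed endpoints (\<open>interval_sum_split\<close>, used once for each coordinate). Finally,
  \<open>alpha\<close> is a lower bound of \<open>P\<^sup>2\<close> over the summed interval, so in a disc of radius \<open>\<rho>\<close> one has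
  \<open>Q\<^sup>2 \<le> \<rho>\<^sup>2 - alpha\<close>, and the hypothesis on \<open>\<rho>\<close> is exactly \<open>\<rho>\<^sup>2 - alpha \<le> (h\<^sub>1 + h\<^sub>2)\<^sup>2\<close>.
  The outer inclusion is the triangle inequality in the plane.\<close>

lemma interval_sum_split:
  fixes a b c d x :: real
  assumes "a \<le> b" "c \<le> d" "a + c \<le> x" "x \<le> b + d"
  obtains y z where "x = y + z" "a \<le> y" "y \<le> b" "c \<le> z" "z \<le> d"
proof
  \<comment> \<open>The least admissible first summand: small enough to leave at least \<open>c\<close>, yet at most \<open>d\<close>,
    for the second.\<close>
  let ?y = "max a (x - d)"
  show "x = ?y + (x - ?y)" "a \<le> ?y" "?y \<le> b" "c \<le> x - ?y" "x - ?y \<le> d"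
    using assms by auto
qed

lemma square_le_beta:
  assumes "pl \<le> p" "p \<le> pu"
  shows "p\<^sup>2 \<le> beta pl pu"
proof (cases "p \<ge> 0")
  case True
  then have "p\<^sup>2 \<le> pu\<^sup>2" using assms by (intro power_mono)
  then show ?thesis by (simp add: beta_def)
next
  case False
  then have "(- p)\<^sup>2 \<le> (- pl)\<^sup>2" using assms by (intro power_mono) auto
  then show ?thesis by (simp add: beta_def)
qed

text \<open>The number squared in \<open>alpha\<close> is the point of the summed interval nearest to \<open>0\<close>.\<close>

lemma alpha_le_square:
  assumes "pl1 + pl2 \<le> p" "p \<le> pu1 + pu2"
  shows "alpha pl1 pu1 pl2 pu2 \<le> p\<^sup>2"
proof -
  have "\<bar>max (pl1 + pl2) (min 0 (pu1 + pu2))\<bar> \<le> \<bar>p\<bar>"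
    using assms by linarith
  then show ?thesis
    by (simp add: alpha_def abs_le_square_iff)
qed

lemma rectangle_subset_pq_set:
  assumes "beta pl pu \<le> r\<^sup>2" "pl \<le> x $ 1" "x $ 1 \<le> pu"
    and "\<bar>x $ 2\<bar> \<le> sqrt (r\<^sup>2 - beta pl pu)"
  shows "x \<in> pq_set pl pu r"
proof -
  have "(x $ 2)\<^sup>2 \<le> r\<^sup>2 - beta pl pu"
    using assms(1) sqrt_ge_absD[OF assms(4)] by simp
  then show ?thesis
    using square_le_beta[OF assms(2,3)] assms(2,3) by (simp add: pq_set_def)
qed

lemma pq_set_subset_sum:
  assumes "pl1 \<le> pu1" "pl2 \<le> pu2"
    and b1: "beta pl1 pu1 \<le> r1\<^sup>2" and b2: "beta pl2 pu2 \<le> r2\<^sup>2"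
    and rho: "\<rho>\<^sup>2 \<le> r1\<^sup>2 + r2\<^sup>2 + alpha pl1 pu1 pl2 pu2 - beta pl1 pu1 - beta pl2 pu2
                   + 2 * sqrt ((r1\<^sup>2 - beta pl1 pu1) * (r2\<^sup>2 - beta pl2 pu2))"
  shows "pq_set (pl1 + pl2) (pu1 + pu2) \<rho> \<subseteq> pq_set pl1 pu1 r1 + pq_set pl2 pu2 r2"
proof
  fix x assume "x \<in> pq_set (pl1 + pl2) (pu1 + pu2) \<rho>"
  then have P: "pl1 + pl2 \<le> x $ 1" "x $ 1 \<le> pu1 + pu2"
    and disc: "(x $ 1)\<^sup>2 + (x $ 2)\<^sup>2 \<le> \<rho>\<^sup>2"
    by (auto simp: pq_set_def)
  define h1 where "h1 = sqrt (r1\<^sup>2 - beta pl1 pu1)"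
  define h2 where "h2 = sqrt (r2\<^sup>2 - beta pl2 pu2)"
  have h: "h1 \<ge> 0" "h2 \<ge> 0" "h1\<^sup>2 = r1\<^sup>2 - beta pl1 pu1" "h2\<^sup>2 = r2\<^sup>2 - beta pl2 pu2"
    using b1 b2 by (auto simp: h1_def h2_def)
  have "(x $ 2)\<^sup>2 \<le> \<rho>\<^sup>2 - alpha pl1 pu1 pl2 pu2"
    using disc alpha_le_square[OF P] by linarith
  also have "\<dots> \<le> (h1 + h2)\<^sup>2"
    using rho h(3,4) by (simp add: power2_sum h1_def h2_def real_sqrt_mult)
  finally have "\<bar>x $ 2\<bar> \<le> h1 + h2"
    using h(1,2) by (simp flip: abs_le_square_iff)
  then have Q: "- h1 + - h2 \<le> x $ 2" "x $ 2 \<le> h1 + h2"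
    by linarith+
  have "- h1 \<le> h1" "- h2 \<le> h2"
    using h(1,2) by linarith+
  from interval_sum_split[OF this Q] obtain q1 q2
    where "x $ 2 = q1 + q2" "- h1 \<le> q1" "q1 \<le> h1" "- h2 \<le> q2" "q2 \<le> h2" .
  then have q: "x $ 2 = q1 + q2" "\<bar>q1\<bar> \<le> h1" "\<bar>q2\<bar> \<le> h2"
    by linarith+
  obtain p1 p2 where p: "x $ 1 = p1 + p2" "pl1 \<le> p1" "p1 \<le> pu1" "pl2 \<le> p2" "p2 \<le> pu2"
    using interval_sum_split[OF assms(1,2) P] by blast
  have "vector [p1, q1] \<in> pq_set pl1 pu1 r1" "vector [p2, q2] \<in> pq_set pl2 pu2 r2"
    using p q b1 b2 by (auto intro!: rectangle_subset_pq_set simp: h1_def h2_def)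
  moreover have "x = vector [p1, q1] + vector [p2, q2]"
    using p(1) q(1) by (simp add: vec_eq_iff forall_2)
  ultimately show "x \<in> pq_set pl1 pu1 r1 + pq_set pl2 pu2 r2"
    by (auto intro: set_plus_intro)
qed

lemma sum_subset_pq_set:
  assumes "r1 \<ge> 0" "r2 \<ge> 0"
  shows "pq_set pl1 pu1 r1 + pq_set pl2 pu2 r2 \<subseteq> pq_set (pl1 + pl2) (pu1 + pu2) (r1 + r2)"
proof
  fix z assume "z \<in> pq_set pl1 pu1 r1 + pq_set pl2 pu2 r2"
  then obtain x y where z: "z = x + y"
    and x: "x \<in> pq_set pl1 pu1 r1" and y: "y \<in> pq_set pl2 pu2 r2"
    by (auto elim: set_plus_elim)
  have "sqrt ((x $ 1)\<^sup>2 + (x $ 2)\<^sup>2) \<le> r1" "sqrt ((y $ 1)\<^sup>2 + (y $ 2)\<^sup>2) \<le> r2"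
    using x y assms by (auto simp: pq_set_def intro: real_le_lsqrt)
  then have "sqrt ((z $ 1)\<^sup>2 + (z $ 2)\<^sup>2) \<le> r1 + r2"
    using real_sqrt_sum_squares_triangle_ineq[of "x $ 1" "y $ 1" "x $ 2" "y $ 2"] z by simp
  then have "(z $ 1)\<^sup>2 + (z $ 2)\<^sup>2 \<le> (r1 + r2)\<^sup>2"
    by (rule sqrt_le_D)
  then show "z \<in> pq_set (pl1 + pl2) (pu1 + pu2) (r1 + r2)"
    using x y z by (simp add: pq_set_def add_mono)
qed

theorem proposition2:
  fixes pl1 pu1 r1 pl2 pu2 r2 :: real
  assumes "r1 > 0" and "r2 > 0"
  shows "(pl1 \<le> pu1 \<and> pl2 \<le> pu2 \<and> beta pl1 pu1 \<le> r1\<^sup>2 \<and> beta pl2 pu2 \<le> r2\<^sup>2 \<longrightarrow>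
            (\<forall>\<rho>>0. \<rho>\<^sup>2 \<le> r1\<^sup>2 + r2\<^sup>2 + alpha pl1 pu1 pl2 pu2 - beta pl1 pu1 - beta pl2 pu2
                         + 2 * sqrt ((r1\<^sup>2 - beta pl1 pu1) * (r2\<^sup>2 - beta pl2 pu2)) \<longrightarrow>
               pq_set (pl1 + pl2) (pu1 + pu2) \<rho> \<subseteq> pq_set pl1 pu1 r1 + pq_set pl2 pu2 r2))
       \<and> pq_set pl1 pu1 r1 + pq_set pl2 pu2 r2 \<subseteq> pq_set (pl1 + pl2) (pu1 + pu2) (r1 + r2)"
  using assms by (intro conjI impI allI pq_set_subset_sum sum_subset_pq_set) auto

end
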